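(* Let $\{\lambda_N\}$ be a sequence of positive numbers such that $\lambda_N\to\infty$ but $\lambda_N^2/N\to0$. Then for any bounded measurable function $g:\mathbb{R}^d\to\mathbb{R}^m$ there is a constant $c>0$ such that, as $N\to\infty$, $$\pi_N\left(\left|\frac1N\sum_{i=1}^N g(x_i)-\int g\,d\pi\right|\ge\frac{\lambda_N}{\sqrt N}\right)\le e^{-c\lambda_N^2+o(\lambda_N^2)},$$ where $\pi=\mu_{\theta_*}$ is the probability measure defined in the context.
   Context: Setting. $\mu$ is a probability measure on $\mathbb{R}^d$, $H:\mathbb{R}^d\to\mathbb{R}^n$ is measurable, $y\in\mathbb{R}^n$ is fixed, $\langle\cdot,\cdot\rangle$ is the usual scalar product in $\mathbb{R}^n$. For each $N\ge1$, $\pi_N$ is the probability measure on $(\mathbb{R}^d)^N$ $$\pi_N(dx)=C_N^{-1}\exp\Bigl(\sum_{i=1}^N\langle y,H(x_i)\rangle-\frac1{2N}\sum_{i,j=1}^N\langle H(x_i),H(x_j)\rangle\Bigr)\bigotimes_{i=1}^N\mu(dx_i),$$ with $C_N$ the normalizing constant. Let $K(\theta)=\log\int e^{\langle\theta,H(x)\rangle}\mu(dx)$ and $\Theta=\{\theta\in\mathbb{R}^n:K(\theta)<\infty\}$. Standing assumptions: $\Theta$ is open (for bounded $H$, $\Theta=\mathbb{R}^n$), and no hyperplane of $\mathbb{R}^n$ contains $H(x)$ for $\mu$-almost every $x$. For $\theta\in\Theta$ define the probability measure $\mu_\theta(dx)=e^{\langle\theta,H(x)\rangle-K(\theta)}\mu(dx)$.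 The point $\theta_*\in\Theta$ is the unique minimizer over $\mathbb{R}^n$ of $J(\theta)=\frac12\|\theta-y\|^2+K(\theta)$ (with $K=+\infty$ outside $\Theta$), equivalently the unique solution of $\theta+\nabla K(\theta)=y$. $|\cdot|$ is the Euclidean norm on $\mathbb{R}^m$. *)

theory Defs
  imports "HOL-Probability.Probability" "HOL-Library.Landau_Symbols"
begin

text \<open>
  The Hamiltonian exponent. A configuration \<open>x\<close> of \<open>N\<close> points is a function on the
  index set \<open>{1..N}\<close>, as in the product measure \<^const>\<open>PiM\<close>.
\<close>

definition energy ::
  "(real^'d \<Rightarrow> real^'n) \<Rightarrow> real^'n \<Rightarrow> nat \<Rightarrow> (nat \<Rightarrow> real^'d) \<Rightarrow> real" where
  "energy H y N x =
     (\<Sum>i\<in>{1..N}. y \<bullet> H (x i))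
     - 1 / (2 * real N) * (\<Sum>i\<in>{1..N}. \<Sum>j\<in>{1..N}. H (x i) \<bullet> H (x j))"

definition norm_const ::
  "(real^'d) measure \<Rightarrow> (real^'d \<Rightarrow> real^'n) \<Rightarrow> real^'n \<Rightarrow> nat \<Rightarrow> ennreal" where
  "norm_const \<mu> H y N =
     (\<integral>\<^sup>+x. ennreal (exp (energy H y N x)) \<partial>(\<Pi>\<^sub>M i\<in>{1..N}. \<mu>))"

definition pi_N ::
  "(real^'d) measure \<Rightarrow> (real^'d \<Rightarrow> real^'n) \<Rightarrow> real^'n \<Rightarrow> nat \<Rightarrow> (nat \<Rightarrow> real^'d) measure" where
  "pi_N \<mu> H y N =
     density (\<Pi>\<^sub>M i\<in>{1..N}. \<mu>)
       (\<lambda>x. ennreal (exp (energy H y N x)) / norm_const \<mu> H y N)"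

text \<open>
  The log-Laplace transform takes values in \<open>(-\<infinity>, \<infinity>]\<close>: for a probability measure \<open>\<mu>\<close> the
  integral is strictly positive, so the real logarithm is meaningful whenever it is finite.
\<close>

definition log_laplace ::
  "(real^'d) measure \<Rightarrow> (real^'d \<Rightarrow> real^'n) \<Rightarrow> real^'n \<Rightarrow> ereal" where
  "log_laplace \<mu> H \<theta> =
     (let I = (\<integral>\<^sup>+x. ennreal (exp (\<theta> \<bullet> H x)) \<partial>\<mu>)
      in if I = \<infinity> then \<infinity> else ereal (ln (enn2real I)))"

definition Theta_dom ::
  "(real^'d) measure \<Rightarrow> (real^'d \<Rightarrow> real^'n) \<Rightarrow> (real^'n) set" where
  "Theta_dom \<mu> H = {\<theta>. log_laplace \<mu> H \<theta> < \<infinity>}"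

definition tilted ::
  "(real^'d) measure \<Rightarrow> (real^'d \<Rightarrow> real^'n) \<Rightarrow> real^'n \<Rightarrow> (real^'d) measure" where
  "tilted \<mu> H \<theta> =
     density \<mu> (\<lambda>x. ennreal (exp (\<theta> \<bullet> H x - real_of_ereal (log_laplace \<mu> H \<theta>))))"

definition J_fun ::
  "(real^'d) measure \<Rightarrow> (real^'d \<Rightarrow> real^'n) \<Rightarrow> real^'n \<Rightarrow> real^'n \<Rightarrow> ereal" where
  "J_fun \<mu> H y \<theta> = ereal ((norm (\<theta> - y))\<^sup>2 / 2) + log_laplace \<mu> H \<theta>"

end

theory Submission
  imports Defs
begin

text \<open>
  Put \<open>m = y - \<theta>\<^sub>*\<close>. Completing the square in the energy shows that \<open>\<pi>\<^sub>N\<close> has density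
  proportional to \<open>exp (- Z)\<close> with respect to the \<open>N\<close>-fold product of the tilted measure \<open>\<pi>\<close>, where
  \<open>Z = \<bar>\<Sum>\<^sub>i (H(x\<^sub>i) - m)\<bar>\<^sup>2 / (2N)\<close>. The first-order condition at the minimiser \<open>\<theta>\<^sub>*\<close> says
  that \<open>m\<close> is the mean of \<open>H\<close> under \<open>\<pi>\<close>, so the expectation of \<open>Z\<close> does not depend on \<open>N\<close>, and by
  Jensen's inequality neither does a positive lower bound for the normalising constant. Since
  \<open>exp (- Z) \<le> 1\<close>, probabilities under \<open>\<pi>\<^sub>N\<close> are at most a constant multiple of those under the
  product measure, which Hoeffding's inequality bounds by a multiple of \<open>exp (- c \<lambda>\<^sub>N\<^sup>2)\<close>. The error
  term \<open>o(\<lambda>\<^sub>N\<^sup>2)\<close> is then a constant.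
\<close>

section \<open>Exponential moments\<close>

text \<open>A remainder bound valid for all real \<open>s\<close>. Multiplying
  \<open>1 - s \<le> exp (- s)\<close> by \<open>exp s\<close> gives
  \<open>exp s - 1 - s \<le> s * (exp s - 1)\<close>, and \<open>\<bar>exp s - 1\<bar> \<le>
  \<bar>s\<bar> * exp \<bar>s\<bar>\<close>. It replaces differentiation under the integral sign
  below.\<close>

lemma exp_le_quadratic:
  fixes s :: real
  shows "exp s \<le> 1 + s + s\<^sup>2 * exp \<bar>s\<bar>"
proof -
  have "1 + (-s) \<le> exp (-s)"
    by (rule exp_ge_add_one_self)
  then have "(1 - s) * exp s \<le> exp (-s) * exp s"
    by (intro mult_right_mono) auto
  then have 1: "exp s - 1 - s \<le> s * (exp s - 1)"
    by (simp add: exp_minus algebra_simps)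
  have 2: "s * (exp s - 1) \<le> \<bar>s\<bar> * \<bar>exp s - 1\<bar>"
    by (metis abs_ge_self abs_mult)
  have 3: "\<bar>exp s - 1\<bar> \<le> \<bar>s\<bar> * exp \<bar>s\<bar>"
  proof (cases "s \<ge> 0")
    case True
    then show ?thesis
      using \<open>(1 - s) * exp s \<le> exp (-s) * exp s\<close> by (simp add: exp_minus algebra_simps)
  next
    case False
    have "exp s < 1"
      using False by simp
    then have "\<bar>exp s - 1\<bar> \<le> \<bar>s\<bar> * 1"
      using False exp_ge_add_one_self[of s] by linarith
    also have "\<dots> \<le> \<bar>s\<bar> * exp \<bar>s\<bar>"
      by (intro mult_left_mono) auto
    finally show ?thesis .
  qed
  have "\<bar>s\<bar> * \<bar>exp s - 1\<bar> \<le> \<bar>s\<bar> * (\<bar>s\<bar> * exp \<bar>s\<bar>)"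
    using 3 by (intro mult_left_mono) auto
  then show ?thesis
    using 1 2 by (simp add: power2_eq_square abs_mult_self_eq flip: mult.assoc)
qed

text \<open>For small \<open>t\<close> the linear term dominates, and its sign can be made negative.
  This is Fermat's criterion at an interior minimum in a form free of derivatives.\<close>

lemma linear_coefficient_zero_of_nonneg:
  fixes a b \<delta> :: real
  assumes "\<delta> > 0" and nonneg: "\<And>t. \<bar>t\<bar> \<le> \<delta> \<Longrightarrow> 0 \<le> t * a + t\<^sup>2 * b"
  shows "a = 0"
proof (rule ccontr)
  assume "a \<noteq> 0"
  \<comment> \<open>The second bound makes the quadratic term at most half the linear one; the
    \<open>+ 1\<close> keeps the denominator positive when \<open>b = 0\<close>.\<close>
  define t where "t = min \<delta> (\<bar>a\<bar> / (2 * (\<bar>b\<bar> + 1)))"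
  have t: "t > 0" "t \<le> \<delta>" and "t \<le> \<bar>a\<bar> / (2 * (\<bar>b\<bar> + 1))"
    using \<open>a \<noteq> 0\<close> \<open>\<delta> > 0\<close> by (auto simp: t_def)
  then have tb: "t * (2 * (\<bar>b\<bar> + 1)) \<le> \<bar>a\<bar>"
    by (subst (asm) pos_le_divide_eq) auto
  have "0 \<le> (- sgn a * t) * a + (- sgn a * t)\<^sup>2 * b"
    using t \<open>a \<noteq> 0\<close> by (intro nonneg) (auto simp: abs_mult abs_sgn_eq)
  also have "\<dots> = t * (- \<bar>a\<bar> + t * b)"
    using \<open>a \<noteq> 0\<close> by (auto simp: sgn_if power2_eq_square algebra_simps)
  finally have "\<bar>a\<bar> \<le> t * b"
    using t by (simp add: zero_le_mult_iff)
  also have "\<dots> \<le> t * \<bar>b\<bar>"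
    using t by (intro mult_left_mono) auto
  finally show False
    using tb t by (simp add: algebra_simps)
qed

context prob_space
begin

text \<open>The two exponential moments add up to a majorant of
  \<open>exp (\<epsilon> * \<bar>X x\<bar>)\<close>, which in turn dominates the square and every
  \<open>exp (t * X x)\<close> with \<open>\<bar>t\<bar> \<le> \<epsilon>\<close>.\<close>

lemma exp_moments:
  fixes X :: "'a \<Rightarrow> real"
  assumes [measurable]: "X \<in> borel_measurable M" and "\<epsilon> > 0"
    and int: "integrable M (\<lambda>x. exp (\<epsilon> * X x))" "integrable M (\<lambda>x. exp (- \<epsilon> * X x))"
  shows "integrable M (\<lambda>x. exp (\<epsilon> * \<bar>X x\<bar>))"
    and "integrable M (\<lambda>x. (X x)\<^sup>2)"
    and "integrable M X"
    and "\<bar>t\<bar> \<le> \<epsilon> \<Longrightarrow> integrable M (\<lambda>x. exp (t * X x))"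
proof -
  show 1: "integrable M (\<lambda>x. exp (\<epsilon> * \<bar>X x\<bar>))"
  proof (rule Bochner_Integration.integrable_bound[OF Bochner_Integration.integrable_add[OF int]])
    have "norm (exp (\<epsilon> * \<bar>X x\<bar>)) \<le> norm (exp (\<epsilon> * X x) + exp (- \<epsilon> * X x))" for x
      using exp_gt_zero[of "\<epsilon> * X x"] exp_gt_zero[of "- \<epsilon> * X x"]
      by (cases "X x \<ge> 0") (simp_all add: abs_of_pos add_pos_pos)
    then show "AE x in M. norm (exp (\<epsilon> * \<bar>X x\<bar>)) \<le> norm (exp (\<epsilon> * X x) + exp (- \<epsilon> * X x))"
      by simp
  qed simp
  \<comment> \<open>The quadratic term of the exponential series at
    \<open>\<epsilon> * \<bar>X x\<bar>\<close>.\<close>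
  have *: "(X x)\<^sup>2 \<le> 2 / \<epsilon>\<^sup>2 * exp (\<epsilon> * \<bar>X x\<bar>)" for x
  proof -
    have "(\<epsilon> * \<bar>X x\<bar>)\<^sup>2 / 2 \<le> exp (\<epsilon> * \<bar>X x\<bar>)"
      using exp_lower_Taylor_quadratic[of "\<epsilon> * \<bar>X x\<bar>"] \<open>\<epsilon> > 0\<close>
        mult_nonneg_nonneg[of \<epsilon> "\<bar>X x\<bar>"] by linarith
    then show ?thesis
      using \<open>\<epsilon> > 0\<close> by (simp add: field_simps power_mult_distrib)
  qed
  show 2: "integrable M (\<lambda>x. (X x)\<^sup>2)"
    by (rule Bochner_Integration.integrable_bound[OF integrable_mult_right[OF 1, of "2 / \<epsilon>\<^sup>2"]])
       (use * \<open>\<epsilon> > 0\<close> in auto)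
  show "integrable M X"
    by (rule square_integrable_imp_integrable) (use 2 in auto)
  show "integrable M (\<lambda>x. exp (t * X x))" if t: "\<bar>t\<bar> \<le> \<epsilon>"
  proof (rule Bochner_Integration.integrable_bound[OF 1])
    have "t * X x \<le> \<epsilon> * \<bar>X x\<bar>" for x
      using mult_right_mono[OF t, of "\<bar>X x\<bar>"] abs_ge_self[of "t * X x"] by (simp add: abs_mult)
    then show "AE x in M. norm (exp (t * X x)) \<le> norm (exp (\<epsilon> * \<bar>X x\<bar>))"
      by simp
  qed simp
qed

text \<open>Integrates \<open>exp_le_quadratic\<close> at \<open>t * X x\<close>. Only
  \<open>\<bar>t\<bar> \<le> \<epsilon> / 2\<close> is allowed because the available exponent
  \<open>\<epsilon>\<close> is split: one half absorbs \<open>exp \<bar>t * X x\<bar>\<close>, the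
  other the factor \<open>(X x)\<^sup>2\<close>.\<close>

lemma expectation_exp_le_quadratic:
  fixes X :: "'a \<Rightarrow> real"
  assumes [measurable]: "X \<in> borel_measurable M" and "\<epsilon> > 0"
    and int: "integrable M (\<lambda>x. exp (\<epsilon> * X x))" "integrable M (\<lambda>x. exp (- \<epsilon> * X x))"
  obtains C where "\<And>t. \<bar>t\<bar> \<le> \<epsilon> / 2 \<Longrightarrow>
    expectation (\<lambda>x. exp (t * X x)) \<le> 1 + t * expectation X + C * t\<^sup>2"
proof
  \<comment> \<open>The factor \<open>8 / \<epsilon>\<^sup>2\<close> comes from
    \<open>s\<^sup>2 / 2 \<le> exp s\<close> at
    \<open>s = \<epsilon> / 2 * \<bar>X x\<bar>\<close>.\<close>
  define C where "C = 8 / \<epsilon>\<^sup>2 * expectation (\<lambda>x. exp (\<epsilon> * \<bar>X x\<bar>))"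
  note i = exp_moments[OF assms]
  fix t assume t: "\<bar>t\<bar> \<le> \<epsilon> / 2"
  have ptw: "exp (t * X x) \<le> 1 + t * X x + t\<^sup>2 * (8 / \<epsilon>\<^sup>2 * exp (\<epsilon> * \<bar>X x\<bar>))" for x
  proof -
    have e: "\<bar>t * X x\<bar> \<le> \<epsilon> / 2 * \<bar>X x\<bar>"
      using mult_right_mono[OF t, of "\<bar>X x\<bar>"] by (simp add: abs_mult)
    have "(\<epsilon> / 2 * \<bar>X x\<bar>)\<^sup>2 / 2 \<le> exp (\<epsilon> / 2 * \<bar>X x\<bar>)"
      using exp_lower_Taylor_quadratic[of "\<epsilon> / 2 * \<bar>X x\<bar>"] \<open>\<epsilon> > 0\<close>
        mult_nonneg_nonneg[of "\<epsilon> / 2" "\<bar>X x\<bar>"] by linarith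
    then have sq: "(X x)\<^sup>2 \<le> 8 / \<epsilon>\<^sup>2 * exp (\<epsilon> / 2 * \<bar>X x\<bar>)"
      using \<open>\<epsilon> > 0\<close> by (simp add: field_simps power_mult_distrib)
    have "(X x)\<^sup>2 * exp \<bar>t * X x\<bar> \<le> (8 / \<epsilon>\<^sup>2 * exp (\<epsilon> / 2 * \<bar>X x\<bar>)) * exp (\<epsilon> / 2 * \<bar>X x\<bar>)"
      using e sq by (intro mult_mono) auto
    also have "\<dots> = 8 / \<epsilon>\<^sup>2 * exp (\<epsilon> * \<bar>X x\<bar>)"
      by (simp flip: exp_add)
    finally have "t\<^sup>2 * ((X x)\<^sup>2 * exp \<bar>t * X x\<bar>) \<le> t\<^sup>2 * (8 / \<epsilon>\<^sup>2 * exp (\<epsilon> * \<bar>X x\<bar>))"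
      by (intro mult_left_mono) auto
    then show ?thesis
      using exp_le_quadratic[of "t * X x"] by (simp add: power_mult_distrib mult.assoc)
  qed
  have "expectation (\<lambda>x. exp (t * X x))
      \<le> expectation (\<lambda>x. 1 + t * X x + t\<^sup>2 * (8 / \<epsilon>\<^sup>2 * exp (\<epsilon> * \<bar>X x\<bar>)))"
    using ptw i t \<open>\<epsilon> > 0\<close> by (intro integral_mono) auto
  also have "\<dots> = 1 + t * expectation X + C * t\<^sup>2"
    using i by (simp add: C_def prob_space)
  finally show "expectation (\<lambda>x. exp (t * X x)) \<le> 1 + t * expectation X + C * t\<^sup>2" .
qed

text \<open>The lower bound is attained at \<open>t = 0\<close>, so the first-order coefficient of
  the right-hand side must vanish there. Since \<open>ln u \<le> u - 1\<close>, the preceding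
  quadratic bound turns that side into a polynomial with linear coefficient
  \<open>a + expectation X\<close>.\<close>

lemma expectation_eq_of_log_mgf_lower_bound:
  fixes X :: "'a \<Rightarrow> real"
  assumes [measurable]: "X \<in> borel_measurable M" and "\<epsilon> > 0"
    and int: "\<And>t. \<bar>t\<bar> \<le> \<epsilon> \<Longrightarrow> integrable M (\<lambda>x. exp (t * X x))"
    and lower: "\<And>t. \<bar>t\<bar> \<le> \<epsilon> \<Longrightarrow>
      0 \<le> t * a + t\<^sup>2 * b + ln (expectation (\<lambda>x. exp (t * X x)))"
  shows "expectation X = - a"
proof -
  have "integrable M (\<lambda>x. exp (\<epsilon> * X x))" "integrable M (\<lambda>x. exp (- \<epsilon> * X x))"
    using int[of \<epsilon>] int[of "- \<epsilon>"] \<open>\<epsilon> > 0\<close> by auto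
  then obtain C where C: "\<And>t. \<bar>t\<bar> \<le> \<epsilon> / 2 \<Longrightarrow>
      expectation (\<lambda>x. exp (t * X x)) \<le> 1 + t * expectation X + C * t\<^sup>2"
    using expectation_exp_le_quadratic[OF assms(1,2)] by blast
  have "0 \<le> t * (a + expectation X) + t\<^sup>2 * (b + C)" if t: "\<bar>t\<bar> \<le> \<epsilon> / 2" for t
  proof -
    have t': "\<bar>t\<bar> \<le> \<epsilon>"
      using t \<open>\<epsilon> > 0\<close> by linarith
    have "expectation (\<lambda>x. exp (t * X x)) > 0"
      using integral_less_AE_space[OF _ int[OF t'], of "\<lambda>_. 0"] by (simp add: emeasure_space_1)
    then have "ln (expectation (\<lambda>x. exp (t * X x))) \<le> t * expectation X + C * t\<^sup>2"
      using ln_le_minus_one[of "expectation (\<lambda>x. exp (t * X x))"] C[OF t] by linarith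
    then show ?thesis
      using lower[OF t'] by (simp add: algebra_simps)
  qed
  then have "a + expectation X = 0"
    using \<open>\<epsilon> > 0\<close> by (intro linear_coefficient_zero_of_nonneg[of "\<epsilon> / 2"]) auto
  then show ?thesis
    by simp
qed

text \<open>Jensen's inequality bounds the normalising constant from below.\<close>

lemma exp_weighted_prob_le:
  fixes Z :: "'a \<Rightarrow> real"
  assumes Z: "integrable M Z" and "\<And>x. Z x \<ge> 0" and "expectation Z \<le> a" and A: "A \<in> events"
  shows "(\<integral>\<^sup>+x. ennreal (exp (- Z x)) * indicator A x \<partial>M) / (\<integral>\<^sup>+x. ennreal (exp (- Z x)) \<partial>M)
    \<le> ennreal (exp a * prob A)"
proof -
  have [measurable]: "Z \<in> borel_measurable M"
    using Z by auto
  have "(\<integral>\<^sup>+x. ennreal (exp (- Z x)) * indicator A x \<partial>M) \<le> (\<integral>\<^sup>+x. indicator A x \<partial>M)"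
    using assms(2) by (intro nn_integral_mono) (auto simp: indicator_def)
  also have "\<dots> = ennreal (prob A)"
    using A by (simp add: emeasure_eq_measure)
  finally have num: "(\<integral>\<^sup>+x. ennreal (exp (- Z x)) * indicator A x \<partial>M) \<le> ennreal (prob A)" .
  have int: "integrable M (\<lambda>x. exp (- Z x))"
    using assms(2) by (intro integrable_const_bound[of _ 1]) auto
  \<comment> \<open>Jensen by hand: the tangent to the exponential at \<open>- a\<close> lies below
    it, and its expectation at \<open>- Z\<close> is at least \<open>exp (- a)\<close> because the
    mean of \<open>Z\<close> is at most \<open>a\<close>.\<close>
  have "exp (- a) \<le> expectation (\<lambda>x. exp (- a) * (1 + (a - Z x)))"
    using Z assms(3) by (simp add: prob_space)
  also have "\<dots> \<le> expectation (\<lambda>x. exp (- Z x))"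
  proof (rule integral_mono)
    show "exp (- a) * (1 + (a - Z x)) \<le> exp (- Z x)" for x
      using mult_left_mono[OF exp_ge_add_one_self[of "a - Z x"], of "exp (- a)"]
      by (simp flip: exp_add)
  qed (use Z int in auto)
  finally have den: "ennreal (exp (- a)) \<le> (\<integral>\<^sup>+x. ennreal (exp (- Z x)) \<partial>M)"
    using int by (simp add: nn_integral_eq_integral)
  have "ennreal (prob A) = ennreal (exp a * prob A) * ennreal (exp (- a))"
    by (simp add: exp_minus flip: ennreal_mult)
  also have "\<dots> \<le> ennreal (exp a * prob A) * (\<integral>\<^sup>+x. ennreal (exp (- Z x)) \<partial>M)"
    using den by (intro mult_left_mono) auto
  finally show ?thesis
    using num den
    by (intro divide_le_posI_ennreal)
       (auto intro: less_le_trans[OF _ den] order_trans simp: mult.commute)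
qed

end

section \<open>Finite powers of a probability measure\<close>

text \<open>Both measures agree on boxes: the indicator of a box is a product over coordinates, so
  the integral factorises. This lets tilting every coordinate be read as one density on the product
  space.\<close>

lemma PiM_density_finite:
  assumes "finite I" and [measurable]: "f \<in> borel_measurable M"
    and "prob_space M" and "prob_space (density M f)"
  shows "(\<Pi>\<^sub>M i\<in>I. density M f) = density (\<Pi>\<^sub>M i\<in>I. M) (\<lambda>x. \<Prod>i\<in>I. f (x i))"
proof -
  interpret M: product_prob_space "\<lambda>_. M" I
    using assms by (intro product_prob_spaceI)
  interpret D: product_prob_space "\<lambda>_. density M f" I
    using assms by (intro product_prob_spaceI)
  show ?thesis
  proof (rule D.PiM_eqI[symmetric])
    show "sets (density (\<Pi>\<^sub>M i\<in>I. M) (\<lambda>x. \<Prod>i\<in>I. f (x i))) = sets (\<Pi>\<^sub>M i\<in>I. density M f)"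
      by (simp cong: sets_PiM_cong)
  next
    fix A assume "\<And>i. i \<in> I \<Longrightarrow> A i \<in> sets (density M f)"
    then have A[measurable]: "\<And>i. i \<in> I \<Longrightarrow> A i \<in> sets M"
      by simp
    have [measurable]: "Pi\<^sub>E I A \<in> sets (\<Pi>\<^sub>M i\<in>I. M)"
      using A assms(1) by (intro sets_PiM_I_finite) auto
    have "emeasure (density (\<Pi>\<^sub>M i\<in>I. M) (\<lambda>x. \<Prod>i\<in>I. f (x i))) (Pi\<^sub>E I A)
        = (\<integral>\<^sup>+x. (\<Prod>i\<in>I. f (x i)) * indicator (Pi\<^sub>E I A) x \<partial>(\<Pi>\<^sub>M i\<in>I. M))"
      by (rule emeasure_density) auto
    also have "\<dots> = (\<integral>\<^sup>+x. (\<Prod>i\<in>I. f (x i) * indicator (A i) (x i)) \<partial>(\<Pi>\<^sub>M i\<in>I. M))"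
    proof (rule nn_integral_cong)
      fix x assume "x \<in> space (\<Pi>\<^sub>M i\<in>I. M)"
      then have "(indicator (Pi\<^sub>E I A) x :: ennreal) = (\<Prod>i\<in>I. indicator (A i) (x i))"
        using assms(1) by (auto simp: indicator_def space_PiM PiE_iff prod_zero_iff)
      then show "(\<Prod>i\<in>I. f (x i)) * indicator (Pi\<^sub>E I A) x
          = (\<Prod>i\<in>I. f (x i) * indicator (A i) (x i))"
        by (simp add: prod.distrib)
    qed
    also have "\<dots> = (\<Prod>i\<in>I. \<integral>\<^sup>+x. f x * indicator (A i) x \<partial>M)"
      using assms(1) by (intro M.product_nn_integral_prod) auto
    also have "\<dots> = (\<Prod>i\<in>I. emeasure (density M f) (A i))"
      by (intro prod.cong) (auto simp: emeasure_density)
    finally show "emeasure (density (\<Pi>\<^sub>M i\<in>I. M) (\<lambda>x. \<Prod>i\<in>I. f (x i))) (Pi\<^sub>E I A)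
        = (\<Prod>i\<in>I. emeasure (density M f) (A i))" .
  qed (use assms in auto)
qed

context prob_space
begin

lemma prob_space_PiM_const: "prob_space (\<Pi>\<^sub>M i\<in>I. M)"
  by (intro prob_space_PiM prob_space_axioms)

lemma integral_PiM_component:
  fixes f :: "'a \<Rightarrow> 'b :: {banach, second_countable_topology}"
  assumes "i \<in> I" and [measurable]: "f \<in> borel_measurable M"
  shows "(\<integral>x. f (x i) \<partial>(\<Pi>\<^sub>M i\<in>I. M)) = expectation f"
    and "integrable (\<Pi>\<^sub>M i\<in>I. M) (\<lambda>x. f (x i)) \<longleftrightarrow> integrable M f"
proof -
  have "distr (\<Pi>\<^sub>M i\<in>I. M) M (\<lambda>x. x i) = M"
    using assms by (intro distr_PiM_component prob_space_axioms)
  moreover have [measurable]: "(\<lambda>x. x i) \<in> (\<Pi>\<^sub>M i\<in>I. M) \<rightarrow>\<^sub>M M"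
    using assms(1) by measurable
  ultimately show "(\<integral>x. f (x i) \<partial>(\<Pi>\<^sub>M i\<in>I. M)) = expectation f"
    and "integrable (\<Pi>\<^sub>M i\<in>I. M) (\<lambda>x. f (x i)) \<longleftrightarrow> integrable M f"
    using integral_distr[of "\<lambda>x. x i" "\<Pi>\<^sub>M i\<in>I. M" M f]
      integrable_distr_eq[of "\<lambda>x. x i" "\<Pi>\<^sub>M i\<in>I. M" M f] by auto
qed

text \<open>Independence means that the joint law is the product of the marginals. Restriction to
  \<open>I\<close> is the identity on the product space, so the joint law of the coordinates is the
  product measure itself.\<close>

lemma indep_vars_PiM_component:
  assumes "finite I" and "I \<noteq> {}" and [measurable]: "f \<in> M \<rightarrow>\<^sub>M N"
  shows "prob_space.indep_vars (\<Pi>\<^sub>M i\<in>I. M) (\<lambda>_. N) (\<lambda>i x. f (x i)) I"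
proof -
  interpret P: prob_space "\<Pi>\<^sub>M i\<in>I. M"
    by (rule prob_space_PiM_const)
  have "P.indep_vars (\<lambda>_. M) (\<lambda>i x. x i) I"
  proof (subst P.indep_vars_iff_distr_eq_PiM')
    have "distr (\<Pi>\<^sub>M i\<in>I. M) (\<Pi>\<^sub>M i\<in>I. M) (\<lambda>x. \<lambda>i\<in>I. x i)
        = distr (\<Pi>\<^sub>M i\<in>I. M) (\<Pi>\<^sub>M i\<in>I. M) (\<lambda>x. x)"
      by (intro distr_cong) (auto simp: space_PiM PiE_restrict)
    also have "\<dots> = (\<Pi>\<^sub>M i\<in>I. M)"
      by (rule distr_id)
    also have "\<dots> = (\<Pi>\<^sub>M i\<in>I. distr (\<Pi>\<^sub>M i\<in>I. M) M (\<lambda>x. x i))"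
      by (intro PiM_cong refl distr_PiM_component[symmetric] prob_space_axioms)
    finally show "distr (\<Pi>\<^sub>M i\<in>I. M) (\<Pi>\<^sub>M i\<in>I. M) (\<lambda>x. \<lambda>i\<in>I. x i)
        = (\<Pi>\<^sub>M i\<in>I. distr (\<Pi>\<^sub>M i\<in>I. M) M (\<lambda>x. x i))" .
  qed (use assms in auto)
  then show ?thesis
    by (rule P.indep_vars_compose2) simp
qed

section \<open>Second moments of sums of independent centred coordinates\<close>

text \<open>Expanding the square leaves only the diagonal terms: off the diagonal, independence and
  centring make the mixed moments vanish.\<close>

lemma expectation_square_sum_PiM:
  fixes f :: "'a \<Rightarrow> real"
  assumes "finite I" and [measurable]: "f \<in> borel_measurable M"
    and sq: "integrable M (\<lambda>x. (f x)\<^sup>2)" and "expectation f = 0"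
  shows "integrable (\<Pi>\<^sub>M i\<in>I. M) (\<lambda>x. (\<Sum>i\<in>I. f (x i))\<^sup>2)"
    and "(\<integral>x. (\<Sum>i\<in>I. f (x i))\<^sup>2 \<partial>(\<Pi>\<^sub>M i\<in>I. M)) = real (card I) * expectation (\<lambda>x. (f x)\<^sup>2)"
proof -
  interpret M: product_prob_space "\<lambda>_. M" I
    by (intro product_prob_spaceI prob_space_axioms)
  have f: "integrable M f"
    by (rule square_integrable_imp_integrable) (use sq in auto)
  have cross: "integrable (\<Pi>\<^sub>M i\<in>I. M) (\<lambda>x. f (x i) * f (x j)) \<and>
      (\<integral>x. f (x i) * f (x j) \<partial>(\<Pi>\<^sub>M i\<in>I. M)) = (if i = j then expectation (\<lambda>x. (f x)\<^sup>2) else 0)"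
    if ij: "i \<in> I" "j \<in> I" for i j
  proof (cases "i = j")
    case True
    then show ?thesis
      using integral_PiM_component[of i I "\<lambda>x. (f x)\<^sup>2"] ij sq by (simp add: power2_eq_square)
  next
    case False
    \<comment> \<open>Padding with the constant 1 writes \<open>f (x i) * f (x j)\<close> as a
      product over all of \<open>I\<close>, to which the product integral formula applies; the
      factor at \<open>i\<close> has mean zero.\<close>
    define h where "h k = (if k \<in> {i, j} then f else (\<lambda>_. 1))" for k
    have h: "integrable M (h k)" for k
      using f by (auto simp: h_def)
    have eq: "(\<Prod>k\<in>I. h k (x k)) = f (x i) * f (x j)" for x
    proof -
      have "(\<Prod>k\<in>I. h k (x k)) = (\<Prod>k\<in>{i, j}. h k (x k))"
        using ij assms(1) by (intro prod.mono_neutral_right) (auto simp: h_def)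
      then show ?thesis
        using False by (simp add: h_def)
    qed
    have "(\<Prod>k\<in>I. expectation (h k)) = 0"
      using ij assms by (intro prod_zero bexI[of _ i]) (auto simp: h_def)
    then show ?thesis
      using M.product_integrable_prod[OF assms(1), of h] M.product_integral_prod[OF assms(1), of h]
        h eq False by simp
  qed
  have expand: "(\<Sum>i\<in>I. f (x i))\<^sup>2 = (\<Sum>i\<in>I. \<Sum>j\<in>I. f (x i) * f (x j))" for x
    by (simp add: power2_eq_square sum_product)
  show "integrable (\<Pi>\<^sub>M i\<in>I. M) (\<lambda>x. (\<Sum>i\<in>I. f (x i))\<^sup>2)"
    unfolding expand using cross by auto
  show "(\<integral>x. (\<Sum>i\<in>I. f (x i))\<^sup>2 \<partial>(\<Pi>\<^sub>M i\<in>I. M)) = real (card I) * expectation (\<lambda>x. (f x)\<^sup>2)"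
    unfolding expand using cross assms(1) by (simp add: Bochner_Integration.integral_sum)
qed

text \<open>Coordinatewise reduction to the scalar case by Parseval. The growth is linear in
  \<open>card I\<close>, which is what cancels the \<open>1 / N\<close> in the interaction
  energy.\<close>

lemma expectation_norm_square_sum_PiM:
  fixes f :: "'a \<Rightarrow> 'b :: euclidean_space"
  assumes "finite I" and [measurable]: "f \<in> borel_measurable M"
    and sq: "\<And>b. b \<in> Basis \<Longrightarrow> integrable M (\<lambda>x. (f x \<bullet> b)\<^sup>2)"
    and mean: "\<And>b. b \<in> Basis \<Longrightarrow> expectation (\<lambda>x. f x \<bullet> b) = 0"
  shows "integrable (\<Pi>\<^sub>M i\<in>I. M) (\<lambda>x. (norm (\<Sum>i\<in>I. f (x i)))\<^sup>2)"
    and "(\<integral>x. (norm (\<Sum>i\<in>I. f (x i)))\<^sup>2 \<partial>(\<Pi>\<^sub>M i\<in>I. M))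
      = real (card I) * expectation (\<lambda>x. (norm (f x))\<^sup>2)"
proof -
  have norm2: "(norm v)\<^sup>2 = (\<Sum>b\<in>Basis. (v \<bullet> b)\<^sup>2)" for v :: 'b
    unfolding power2_norm_eq_inner by (subst euclidean_inner) (simp add: power2_eq_square)
  note b = expectation_square_sum_PiM[OF assms(1) _ sq mean]
  show "integrable (\<Pi>\<^sub>M i\<in>I. M) (\<lambda>x. (norm (\<Sum>i\<in>I. f (x i)))\<^sup>2)"
    unfolding norm2 inner_sum_left by (intro Bochner_Integration.integrable_sum b) auto
  show "(\<integral>x. (norm (\<Sum>i\<in>I. f (x i)))\<^sup>2 \<partial>(\<Pi>\<^sub>M i\<in>I. M))
      = real (card I) * expectation (\<lambda>x. (norm (f x))\<^sup>2)"
    unfolding norm2 inner_sum_left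
    by (simp add: Bochner_Integration.integral_sum b sq sum_distrib_left)
qed

section \<open>Concentration of empirical means under the product measure\<close>

lemma Hoeffding_PiM:
  fixes f :: "'a \<Rightarrow> real" and B \<epsilon> :: real
  assumes "finite I" "I \<noteq> {}" and [measurable]: "f \<in> borel_measurable M"
    and "B > 0" and bound: "\<And>x. \<bar>f x\<bar> \<le> B" and "\<epsilon> \<ge> 0"
  shows "measure (\<Pi>\<^sub>M i\<in>I. M) {x \<in> space (\<Pi>\<^sub>M i\<in>I. M).
      \<bar>(\<Sum>i\<in>I. f (x i)) / card I - expectation f\<bar> \<ge> \<epsilon>} \<le> 2 * exp (- real (card I) * \<epsilon>\<^sup>2 / (2 * B\<^sup>2))"
proof -
  interpret P: prob_space "\<Pi>\<^sub>M i\<in>I. M"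
    by (rule prob_space_PiM_const)
  have card: "card I > 0"
    using assms by (simp add: card_gt_0_iff)
  interpret Hoeffding_ineq "\<Pi>\<^sub>M i\<in>I. M" I "\<lambda>i x. f (x i)" "\<lambda>_. - B" "\<lambda>_. B" "card I * expectation f"
  proof unfold_locales
    show "P.indep_vars (\<lambda>_. borel) (\<lambda>i x. f (x i)) I"
      using assms by (intro indep_vars_PiM_component) auto
    show "AE x in \<Pi>\<^sub>M i\<in>I. M. f (x i) \<in> {- B..B}" for i
      using bound[of "_ i"] by (intro AE_I2) (simp add: abs_le_iff minus_le_iff)
    show "card I * expectation f \<equiv> \<Sum>i\<in>I. \<integral>x. f (x i) \<partial>(\<Pi>\<^sub>M i\<in>I. M)"
      by (simp add: integral_PiM_component)
  qed (use assms in auto)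
  have pos: "(\<Sum>i\<in>I. (B - - B)\<^sup>2) > 0"
    using card \<open>B > 0\<close> by simp
  have set: "{x \<in> space (\<Pi>\<^sub>M i\<in>I. M). \<bar>(\<Sum>i\<in>I. f (x i)) / card I - expectation f\<bar> \<ge> \<epsilon>}
      = {x \<in> space (\<Pi>\<^sub>M i\<in>I. M). \<bar>(\<Sum>i\<in>I. f (x i)) - real (card I) * expectation f\<bar> \<ge> card I * \<epsilon>}"
  proof (intro Collect_cong conj_cong refl)
    fix x
    have "(\<Sum>i\<in>I. f (x i)) - real (card I) * expectation f
        = card I * ((\<Sum>i\<in>I. f (x i)) / card I - expectation f)"
      using card by (simp add: field_simps)
    then show "\<bar>(\<Sum>i\<in>I. f (x i)) / card I - expectation f\<bar> \<ge> \<epsilon> \<longleftrightarrow>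
        \<bar>(\<Sum>i\<in>I. f (x i)) - real (card I) * expectation f\<bar> \<ge> card I * \<epsilon>"
      using card by (simp add: abs_mult)
  qed
  \<comment> \<open>Each summand ranges over an interval of length \<open>2 * B\<close>, and the
    deviation of the sum is \<open>card I\<close> times that of the mean.\<close>
  have "- 2 * (card I * \<epsilon>)\<^sup>2 / (\<Sum>i\<in>I. (B - - B)\<^sup>2) = - real (card I) * \<epsilon>\<^sup>2 / (2 * B\<^sup>2)"
    using card \<open>B > 0\<close> by (simp add: field_simps power2_eq_square)
  then show ?thesis
    unfolding set using Hoeffding_ineq_abs_ge[OF _ pos, of "card I * \<epsilon>"] \<open>\<epsilon> \<ge> 0\<close> by simp
qed

text \<open>A union bound over the basis: if every coordinate deviates by less than
  \<open>\<epsilon> / DIM('b)\<close>, the l1 norm of the deviation, hence its Euclidean norm, is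
  below \<open>\<epsilon>\<close>. The crude dependence on the dimension only affects
  constants.\<close>

lemma Hoeffding_PiM_vector:
  fixes f :: "'a \<Rightarrow> 'b :: euclidean_space" and B \<epsilon> :: real
  assumes "finite I" "I \<noteq> {}" and [measurable]: "f \<in> borel_measurable M"
    and "B > 0" and bound: "\<And>x. norm (f x) \<le> B" and "\<epsilon> \<ge> 0"
  shows "measure (\<Pi>\<^sub>M i\<in>I. M) {x \<in> space (\<Pi>\<^sub>M i\<in>I. M).
      norm ((1 / card I) *\<^sub>R (\<Sum>i\<in>I. f (x i)) - expectation f) \<ge> \<epsilon>}
    \<le> 2 * real DIM('b) * exp (- real (card I) * \<epsilon>\<^sup>2 / (2 * (B * DIM('b))\<^sup>2))"
proof -
  interpret P: prob_space "\<Pi>\<^sub>M i\<in>I. M"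
    by (rule prob_space_PiM_const)
  define \<delta> where "\<delta> = \<epsilon> / DIM('b)"
  define A where "A b = {x \<in> space (\<Pi>\<^sub>M i\<in>I. M).
      \<bar>(\<Sum>i\<in>I. f (x i) \<bullet> b) / card I - expectation (\<lambda>x. f x \<bullet> b)\<bar> \<ge> \<delta>}" for b :: 'b
  have [measurable]: "A b \<in> P.events" for b
    unfolding A_def by measurable
  have int: "integrable M f"
    using bound by (intro integrable_const_bound[of _ B]) auto
  have "{x \<in> space (\<Pi>\<^sub>M i\<in>I. M).
      norm ((1 / card I) *\<^sub>R (\<Sum>i\<in>I. f (x i)) - expectation f) \<ge> \<epsilon>} \<subseteq> (\<Union>b\<in>Basis. A b)"
  proof (rule subsetI, rule ccontr)
    fix x
    let ?v = "(1 / card I) *\<^sub>R (\<Sum>i\<in>I. f (x i)) - expectation f"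
    assume x: "x \<in> {x \<in> space (\<Pi>\<^sub>M i\<in>I. M).
        norm ((1 / card I) *\<^sub>R (\<Sum>i\<in>I. f (x i)) - expectation f) \<ge> \<epsilon>}"
      and "x \<notin> (\<Union>b\<in>Basis. A b)"
    then have "\<bar>?v \<bullet> b\<bar> < \<delta>" if "b \<in> Basis" for b
      using that int by (auto simp: A_def inner_diff_left inner_sum_left not_le)
    then have "(\<Sum>b\<in>Basis. \<bar>?v \<bullet> b\<bar>) < (\<Sum>b\<in>(Basis :: 'b set). \<delta>)"
      by (intro sum_strict_mono) auto
    also have "\<dots> = \<epsilon>"
      by (simp add: \<delta>_def)
    finally show False
      using x norm_le_l1[of ?v] by simp
  qed
  then have "P.prob {x \<in> space (\<Pi>\<^sub>M i\<in>I. M).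
      norm ((1 / card I) *\<^sub>R (\<Sum>i\<in>I. f (x i)) - expectation f) \<ge> \<epsilon>} \<le> P.prob (\<Union>b\<in>Basis. A b)"
    by (intro P.finite_measure_mono) auto
  also have "\<dots> \<le> (\<Sum>b\<in>Basis. P.prob (A b))"
    by (intro P.finite_measure_subadditive_finite) auto
  also have "\<dots> \<le> (\<Sum>b\<in>(Basis :: 'b set). 2 * exp (- real (card I) * \<delta>\<^sup>2 / (2 * B\<^sup>2)))"
  proof (rule sum_mono)
    fix b :: 'b assume b: "b \<in> Basis"
    have "\<bar>f x \<bullet> b\<bar> \<le> B" for x
      using Basis_le_norm[OF b, of "f x"] bound[of x] by linarith
    then show "P.prob (A b) \<le> 2 * exp (- real (card I) * \<delta>\<^sup>2 / (2 * B\<^sup>2))"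
      unfolding A_def using assms by (intro Hoeffding_PiM) (auto simp: \<delta>_def)
  qed
  also have "\<dots> = 2 * real DIM('b) * exp (- real (card I) * \<epsilon>\<^sup>2 / (2 * (B * DIM('b))\<^sup>2))"
    by (simp add: \<delta>_def power_divide power_mult_distrib mult_ac)
  finally show ?thesis .
qed

end

section \<open>The tilted measure and the Gibbs measure\<close>

lemma log_laplace_eq_ln_integral:
  assumes "integrable \<mu> (\<lambda>x. exp (\<theta> \<bullet> H x))"
  shows "log_laplace \<mu> H \<theta> = ereal (ln (\<integral>x. exp (\<theta> \<bullet> H x) \<partial>\<mu>))"
  using assms by (simp add: log_laplace_def nn_integral_eq_integral Bochner_Integration.integral_nonneg)

lemma Theta_dom_iff_integrable:
  assumes [measurable]: "H \<in> borel_measurable \<mu>"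
  shows "\<theta> \<in> Theta_dom \<mu> H \<longleftrightarrow> integrable \<mu> (\<lambda>x. exp (\<theta> \<bullet> H x))"
  by (auto simp: Theta_dom_def log_laplace_def Let_def integrable_iff_bounded less_top split: if_splits)

lemma tilted_eq_density:
  assumes "prob_space \<mu>" and [measurable]: "H \<in> borel_measurable \<mu>" and "\<theta> \<in> Theta_dom \<mu> H"
  defines "L \<equiv> (\<integral>x. exp (\<theta> \<bullet> H x) \<partial>\<mu>)"
  shows "L > 0" and "tilted \<mu> H \<theta> = density \<mu> (\<lambda>x. ennreal (exp (\<theta> \<bullet> H x) / L))"
    and "prob_space (tilted \<mu> H \<theta>)"
proof -
  interpret prob_space \<mu>
    by fact
  have int: "integrable \<mu> (\<lambda>x. exp (\<theta> \<bullet> H x))"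
    using assms by (simp add: Theta_dom_iff_integrable)
  show L: "L > 0"
    unfolding L_def using integral_less_AE_space[OF _ int, of "\<lambda>_. 0"]
    by (simp add: emeasure_space_1)
  show eq: "tilted \<mu> H \<theta> = density \<mu> (\<lambda>x. ennreal (exp (\<theta> \<bullet> H x) / L))"
    using L by (simp add: tilted_def log_laplace_eq_ln_integral[OF int] exp_diff flip: L_def)
  have "(\<integral>\<^sup>+x. ennreal (exp (\<theta> \<bullet> H x) / L) \<partial>\<mu>) = ennreal (\<integral>x. exp (\<theta> \<bullet> H x) / L \<partial>\<mu>)"
    using L int by (intro nn_integral_eq_integral) auto
  also have "\<dots> = 1"
    using L by (simp add: L_def)
  finally show "prob_space (tilted \<mu> H \<theta>)"
    unfolding eq by (intro prob_spaceI) (simp add: emeasure_density cong: nn_integral_cong)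
qed

text \<open>Tilting by \<open>\<theta>\<close> and then by \<open>v\<close> amounts to tilting by
  \<open>\<theta> + v\<close>, so the moment generating function under the tilted measure is a ratio
  of two Laplace transforms.\<close>

lemma mgf_tilted:
  assumes "prob_space \<mu>" and [measurable]: "H \<in> borel_measurable \<mu>"
    and "\<theta> \<in> Theta_dom \<mu> H" "\<theta> + v \<in> Theta_dom \<mu> H"
  shows "integrable (tilted \<mu> H \<theta>) (\<lambda>x. exp (v \<bullet> H x))"
    and "log_laplace \<mu> H (\<theta> + v)
      = log_laplace \<mu> H \<theta> + ereal (ln (\<integral>x. exp (v \<bullet> H x) \<partial>tilted \<mu> H \<theta>))"
proof -
  interpret prob_space \<mu>
    by fact
  define L where "L \<theta> = (\<integral>x. exp (\<theta> \<bullet> H x) \<partial>\<mu>)" for \<theta>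
  note t = tilted_eq_density[OF assms(1-3), folded L_def]
  have pos: "L (\<theta> + v) > 0"
    using tilted_eq_density(1)[OF assms(1,2,4)] by (simp add: L_def)
  have int: "integrable \<mu> (\<lambda>x. exp (\<theta> \<bullet> H x))" "integrable \<mu> (\<lambda>x. exp ((\<theta> + v) \<bullet> H x))"
    using assms by (simp_all add: Theta_dom_iff_integrable)
  have eq: "exp (\<theta> \<bullet> H x) / L \<theta> * exp (v \<bullet> H x) = exp ((\<theta> + v) \<bullet> H x) / L \<theta>" for x
    by (simp add: inner_add_left exp_add)
  have "integrable \<mu> (\<lambda>x. exp (\<theta> \<bullet> H x) / L \<theta> * exp (v \<bullet> H x))"
    unfolding eq using int by simp
  then show "integrable (tilted \<mu> H \<theta>) (\<lambda>x. exp (v \<bullet> H x))"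
    unfolding t(2) using t(1) by (subst integrable_real_density) auto
  have "(\<integral>x. exp (v \<bullet> H x) \<partial>tilted \<mu> H \<theta>)
      = (\<integral>x. exp (\<theta> \<bullet> H x) / L \<theta> * exp (v \<bullet> H x) \<partial>\<mu>)"
    unfolding t(2) using t(1) by (subst integral_real_density) auto
  also have "\<dots> = L (\<theta> + v) / L \<theta>"
    unfolding eq by (simp add: L_def)
  finally have "(\<integral>x. exp (v \<bullet> H x) \<partial>tilted \<mu> H \<theta>) = L (\<theta> + v) / L \<theta>" .
  then show "log_laplace \<mu> H (\<theta> + v)
      = log_laplace \<mu> H \<theta> + ereal (ln (\<integral>x. exp (v \<bullet> H x) \<partial>tilted \<mu> H \<theta>))"
    using pos t(1) by (simp add: log_laplace_eq_ln_integral[OF int(1)]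
        log_laplace_eq_ln_integral[OF int(2)] ln_div flip: L_def)
qed

section \<open>The first-order condition at the minimiser\<close>

text \<open>Openness of the domain gives two-sided exponential moments of
  \<open>v \<bullet> H x\<close>, hence integrability. Comparing \<open>J_fun\<close> at
  \<open>\<theta>\<close> and \<open>\<theta> + t *\<^sub>R v\<close> bounds the log moment
  generating function from below; the resulting mean is the equation
  \<open>\<theta> + \<nabla>K(\<theta>) = y\<close> tested against \<open>v\<close>.\<close>

lemma tilted_moments_at_minimizer:
  assumes "prob_space \<mu>" and [measurable]: "H \<in> borel_measurable \<mu>"
    and "open (Theta_dom \<mu> H)" "\<theta> \<in> Theta_dom \<mu> H" "is_arg_min (J_fun \<mu> H y) (\<lambda>_. True) \<theta>"
  shows "integrable (tilted \<mu> H \<theta>) (\<lambda>x. (v \<bullet> H x)\<^sup>2)"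
    and "integrable (tilted \<mu> H \<theta>) (\<lambda>x. v \<bullet> H x)"
    and "(\<integral>x. v \<bullet> H x \<partial>tilted \<mu> H \<theta>) = v \<bullet> (y - \<theta>)"
proof -
  interpret T: prob_space "tilted \<mu> H \<theta>"
    by (rule tilted_eq_density) fact+
  have [measurable]: "H \<in> borel_measurable (tilted \<mu> H \<theta>)"
    by (simp add: tilted_def)
  obtain e where e: "e > 0" "cball \<theta> e \<subseteq> Theta_dom \<mu> H"
    using assms(3,4) open_contains_cball by blast
  \<comment> \<open>Keeps the segment \<open>\<theta> + t *\<^sub>R v\<close> inside the ball of
    radius \<open>e\<close>; the \<open>+ 1\<close> covers \<open>v = 0\<close>.\<close>
  define \<epsilon> where "\<epsilon> = e / (norm v + 1)"
  have \<epsilon>: "\<epsilon> > 0"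
    using e by (simp add: \<epsilon>_def add_nonneg_pos)
  have dom: "\<theta> + t *\<^sub>R v \<in> Theta_dom \<mu> H" if "\<bar>t\<bar> \<le> \<epsilon>" for t
  proof -
    have "\<bar>t\<bar> * norm v \<le> \<epsilon> * (norm v + 1)"
      using that \<epsilon> by (intro mult_mono) auto
    also have "\<dots> = e"
      by (simp add: \<epsilon>_def add_nonneg_eq_0_iff)
    finally show ?thesis
      using e(2) by (auto simp: dist_norm)
  qed
  have int: "integrable (tilted \<mu> H \<theta>) (\<lambda>x. exp (t * (v \<bullet> H x)))" if "\<bar>t\<bar> \<le> \<epsilon>" for t
    using mgf_tilted(1)[OF assms(1,2,4) dom[OF that]] by simp
  have int': "integrable (tilted \<mu> H \<theta>) (\<lambda>x. exp (\<epsilon> * (v \<bullet> H x)))"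
    "integrable (tilted \<mu> H \<theta>) (\<lambda>x. exp (- \<epsilon> * (v \<bullet> H x)))"
    using int[of \<epsilon>] int[of "- \<epsilon>"] \<epsilon> by auto
  show "integrable (tilted \<mu> H \<theta>) (\<lambda>x. (v \<bullet> H x)\<^sup>2)"
    and "integrable (tilted \<mu> H \<theta>) (\<lambda>x. v \<bullet> H x)"
    by (rule T.exp_moments(2,3)[OF _ \<epsilon> int'], simp)+
  have "T.expectation (\<lambda>x. v \<bullet> H x) = - (v \<bullet> (\<theta> - y))"
  proof (rule T.expectation_eq_of_log_mgf_lower_bound[OF _ \<epsilon> int, where b = "(norm v)\<^sup>2 / 2"])
    fix t assume t: "\<bar>t\<bar> \<le> \<epsilon>"
    \<comment> \<open>The value at \<open>\<theta>\<close> is finite, so it cancels from both sides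
      of the extended real inequality.\<close>
    obtain k where k: "log_laplace \<mu> H \<theta> = ereal k"
      using log_laplace_eq_ln_integral assms(2,4) Theta_dom_iff_integrable by metis
    have "J_fun \<mu> H y \<theta> \<le> J_fun \<mu> H y (\<theta> + t *\<^sub>R v)"
      using assms(5) by (auto simp: is_arg_min_def not_less)
    then have "(norm (\<theta> - y))\<^sup>2 / 2
        \<le> (norm (\<theta> + t *\<^sub>R v - y))\<^sup>2 / 2 + ln (T.expectation (\<lambda>x. exp (t * (v \<bullet> H x))))"
      by (simp add: J_fun_def mgf_tilted(2)[OF assms(1,2,4) dom[OF t]] k)
    moreover have "(norm (\<theta> + t *\<^sub>R v - y))\<^sup>2
        = (norm (\<theta> - y))\<^sup>2 + 2 * t * (v \<bullet> (\<theta> - y)) + t\<^sup>2 * (norm v)\<^sup>2"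
      unfolding power2_norm_eq_inner
      by (simp add: inner_simps inner_commute algebra_simps power2_eq_square)
    ultimately show "0 \<le> t * (v \<bullet> (\<theta> - y)) + t\<^sup>2 * ((norm v)\<^sup>2 / 2)
        + ln (T.expectation (\<lambda>x. exp (t * (v \<bullet> H x))))"
      by (simp add: field_simps)
  qed auto
  then show "(\<integral>x. v \<bullet> H x \<partial>tilted \<mu> H \<theta>) = v \<bullet> (y - \<theta>)"
    by (simp add: inner_diff_right)
qed

text \<open>Completing the square around \<open>y - \<theta>\<close>.\<close>

lemma energy_eq:
  assumes "N \<ge> 1"
  shows "energy H y N x = (\<Sum>i\<in>{1..N}. \<theta> \<bullet> H (x i))
    - (norm (\<Sum>i\<in>{1..N}. H (x i) - (y - \<theta>)))\<^sup>2 / (2 * real N) + real N * (norm (y - \<theta>))\<^sup>2 / 2"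
proof -
  define S where "S = (\<Sum>i\<in>{1..N}. H (x i))"
  have 1: "(\<Sum>i\<in>{1..N}. v \<bullet> H (x i)) = v \<bullet> S" for v
    by (simp add: S_def inner_sum_right)
  have 2: "(\<Sum>i\<in>{1..N}. \<Sum>j\<in>{1..N}. H (x i) \<bullet> H (x j)) = S \<bullet> S"
    by (simp add: S_def inner_sum_right inner_sum_left) (rule sum.swap)
  have 3: "(\<Sum>i\<in>{1..N}. H (x i) - (y - \<theta>)) = S - real N *\<^sub>R (y - \<theta>)"
    by (simp add: S_def sum_subtractf scaleR_conv_of_real sum_constant_scaleR)
  show ?thesis
    unfolding energy_def 2 unfolding 1 3 power2_norm_eq_inner using assms
    by (simp add: inner_simps inner_commute field_simps power2_eq_square)
qed

lemma ennreal_mult_divide_cancel_left: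
  fixes a b :: ennreal and c :: real
  assumes "c > 0"
  shows "ennreal c * a / (ennreal c * b) = a / b"
  using assms
  by (cases a b rule: ennreal2_cases; cases "b = 0")
     (auto simp: divide_ennreal ennreal_mult_top ennreal_mult_eq_top_iff ennreal_top_divide
       simp flip: ennreal_mult)

lemma emeasure_pi_N:
  fixes H :: "real^'d \<Rightarrow> real^'n" and y :: "real^'n"
  assumes "prob_space \<mu>" and [measurable]: "H \<in> borel_measurable \<mu>" and \<theta>: "\<theta> \<in> Theta_dom \<mu> H"
    and "N \<ge> 1" and A[measurable]: "A \<in> sets (\<Pi>\<^sub>M i\<in>{1..N}. \<mu>)"
  defines "Z \<equiv> \<lambda>x. (norm (\<Sum>i\<in>{1..N}. H (x i) - (y - \<theta>)))\<^sup>2 / (2 * real N)"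
    and "P \<equiv> \<Pi>\<^sub>M i\<in>{1..N}. tilted \<mu> H \<theta>"
  shows "emeasure (pi_N \<mu> H y N) A
    = (\<integral>\<^sup>+x. ennreal (exp (- Z x)) * indicator A x \<partial>P) / (\<integral>\<^sup>+x. ennreal (exp (- Z x)) \<partial>P)"
proof -
  define L where "L = (\<integral>x. exp (\<theta> \<bullet> H x) \<partial>\<mu>)"
  note t = tilted_eq_density[OF assms(1-3), folded L_def]
  \<comment> \<open>All factors independent of \<open>x\<close>: the constant left by completing the
    square and the \<open>N\<close> normalisers of the tilted factors. It cancels between numerator
    and normalising constant.\<close>
  define c where "c = exp (real N * (norm (y - \<theta>))\<^sup>2 / 2) * L ^ N"
  have c: "c > 0"
    using t(1) by (simp add: c_def)
  have P: "P = density (\<Pi>\<^sub>M i\<in>{1..N}. \<mu>) (\<lambda>x. \<Prod>i\<in>{1..N}. ennreal (exp (\<theta> \<bullet> H (x i)) / L))"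
    unfolding P_def t(2) using assms(1) t(2,3) by (intro PiM_density_finite) auto
  have weight: "ennreal (exp (energy H y N x))
      = ennreal c * ((\<Prod>i\<in>{1..N}. ennreal (exp (\<theta> \<bullet> H (x i)) / L)) * ennreal (exp (- Z x)))" for x
  proof -
    have "energy H y N x
        = (\<Sum>i\<in>{1..N}. \<theta> \<bullet> H (x i)) + - Z x + real N * (norm (y - \<theta>))\<^sup>2 / 2"
      by (simp add: energy_eq[OF \<open>N \<ge> 1\<close>, where \<theta> = \<theta>] Z_def)
    then have "exp (energy H y N x) = c * ((\<Prod>i\<in>{1..N}. exp (\<theta> \<bullet> H (x i)) / L) * exp (- Z x))"
      using t(1) by (simp only: exp_add exp_sum[OF finite_atLeastAtMost]) (simp add: c_def prod_dividef)
    then show ?thesis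
      using c t(1) by (simp add: prod_ennreal prod_nonneg flip: ennreal_mult)
  qed
  have [measurable]: "energy H y N \<in> borel_measurable (\<Pi>\<^sub>M i\<in>{1..N}. \<mu>)"
    "Z \<in> borel_measurable (\<Pi>\<^sub>M i\<in>{1..N}. \<mu>)"
    unfolding energy_def Z_def by measurable
  \<comment> \<open>Needed for two weights: \<open>g = 1\<close> gives the normalising constant, the
    indicator of \<open>A\<close> the unnormalised mass of the event.\<close>
  have integral: "(\<integral>\<^sup>+x. ennreal (exp (energy H y N x)) * g x \<partial>(\<Pi>\<^sub>M i\<in>{1..N}. \<mu>))
      = ennreal c * (\<integral>\<^sup>+x. ennreal (exp (- Z x)) * g x \<partial>P)"
    if [measurable]: "g \<in> borel_measurable (\<Pi>\<^sub>M i\<in>{1..N}. \<mu>)" for g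
  proof -
    have "(\<integral>\<^sup>+x. ennreal (exp (energy H y N x)) * g x \<partial>(\<Pi>\<^sub>M i\<in>{1..N}. \<mu>))
        = (\<integral>\<^sup>+x. ennreal c * ((\<Prod>i\<in>{1..N}. ennreal (exp (\<theta> \<bullet> H (x i)) / L))
            * (ennreal (exp (- Z x)) * g x)) \<partial>(\<Pi>\<^sub>M i\<in>{1..N}. \<mu>))"
      by (simp add: weight mult.assoc)
    also have "\<dots> = ennreal c * (\<integral>\<^sup>+x. (\<Prod>i\<in>{1..N}. ennreal (exp (\<theta> \<bullet> H (x i)) / L))
            * (ennreal (exp (- Z x)) * g x) \<partial>(\<Pi>\<^sub>M i\<in>{1..N}. \<mu>))"
      by (intro nn_integral_cmult) measurable
    also have "(\<integral>\<^sup>+x. (\<Prod>i\<in>{1..N}. ennreal (exp (\<theta> \<bullet> H (x i)) / L))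
            * (ennreal (exp (- Z x)) * g x) \<partial>(\<Pi>\<^sub>M i\<in>{1..N}. \<mu>))
        = (\<integral>\<^sup>+x. ennreal (exp (- Z x)) * g x \<partial>P)"
      unfolding P by (rule nn_integral_density[symmetric]) measurable
    finally show ?thesis .
  qed
  have norm_const: "norm_const \<mu> H y N = ennreal c * (\<integral>\<^sup>+x. ennreal (exp (- Z x)) \<partial>P)"
    unfolding norm_const_def using integral[of "\<lambda>_. 1"] by simp
  have "emeasure (pi_N \<mu> H y N) A = (\<integral>\<^sup>+x. ennreal (exp (energy H y N x)) / norm_const \<mu> H y N
      * indicator A x \<partial>(\<Pi>\<^sub>M i\<in>{1..N}. \<mu>))"
    unfolding pi_N_def by (rule emeasure_density) measurable
  also have "\<dots> = (\<integral>\<^sup>+x. ennreal (exp (energy H y N x)) * indicator A x / norm_const \<mu> H y N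
      \<partial>(\<Pi>\<^sub>M i\<in>{1..N}. \<mu>))"
    by (intro nn_integral_cong) (simp add: ennreal_times_divide mult.commute)
  also have "\<dots> = (\<integral>\<^sup>+x. ennreal (exp (energy H y N x)) * indicator A x \<partial>(\<Pi>\<^sub>M i\<in>{1..N}. \<mu>))
      / norm_const \<mu> H y N"
    by (rule nn_integral_divide) measurable
  also have "\<dots> = (ennreal c * (\<integral>\<^sup>+x. ennreal (exp (- Z x)) * indicator A x \<partial>P))
      / (ennreal c * (\<integral>\<^sup>+x. ennreal (exp (- Z x)) \<partial>P))"
    unfolding norm_const integral[OF borel_measurable_indicator[OF A]] by (rule refl)
  also have "\<dots> = (\<integral>\<^sup>+x. ennreal (exp (- Z x)) * indicator A x \<partial>P)
      / (\<integral>\<^sup>+x. ennreal (exp (- Z x)) \<partial>P)"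
    using c by (rule ennreal_mult_divide_cancel_left)
  finally show ?thesis .
qed

section \<open>Transfer of concentration to the Gibbs measure\<close>

text \<open>A bound for each fixed \<open>N\<close>: the Gibbs measure costs only the factor
  \<open>exp a\<close> over the product measure, where \<open>a\<close> is half the total variance
  of \<open>H\<close> under the tilted measure and so does not depend on \<open>N\<close>.\<close>

lemma pi_N_deviation_le:
  fixes g :: "real^'d \<Rightarrow> 'b :: euclidean_space" and B \<epsilon> :: real
  assumes "prob_space \<mu>" and [measurable]: "H \<in> borel_measurable \<mu>"
    and "open (Theta_dom \<mu> H)" "\<theta> \<in> Theta_dom \<mu> H" "is_arg_min (J_fun \<mu> H y) (\<lambda>_. True) \<theta>"
    and [measurable]: "g \<in> borel_measurable \<mu>" and B: "B > 0" "\<And>x. norm (g x) \<le> B"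
    and "N \<ge> 1" and "\<epsilon> \<ge> 0"
  defines "a \<equiv> (\<integral>x. (norm (H x - (y - \<theta>)))\<^sup>2 \<partial>tilted \<mu> H \<theta>) / 2"
  shows "measure (pi_N \<mu> H y N) {x \<in> space (pi_N \<mu> H y N).
      norm ((1 / real N) *\<^sub>R (\<Sum>i\<in>{1..N}. g (x i)) - (\<integral>x. g x \<partial>tilted \<mu> H \<theta>)) \<ge> \<epsilon>}
    \<le> exp a * (2 * real DIM('b) * exp (- real N * \<epsilon>\<^sup>2 / (2 * (B * DIM('b))\<^sup>2)))"
proof -
  interpret T: prob_space "tilted \<mu> H \<theta>"
    by (rule tilted_eq_density) fact+
  have sets_T[measurable_cong]: "sets (tilted \<mu> H \<theta>) = sets \<mu>"
    by (simp add: tilted_def)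
  define P where "P = (\<Pi>\<^sub>M i\<in>{1..N}. tilted \<mu> H \<theta>)"
  have sets_P: "sets P = sets (\<Pi>\<^sub>M i\<in>{1..N}. \<mu>)"
    unfolding P_def by (intro sets_PiM_cong) (auto simp: sets_T)
  have space_P: "space (pi_N \<mu> H y N) = space P"
    using sets_eq_imp_space_eq[OF sets_P] by (simp add: pi_N_def)
  interpret P: prob_space P
    unfolding P_def by (rule T.prob_space_PiM_const)
  define Z where "Z x = (norm (\<Sum>i\<in>{1..N}. H (x i) - (y - \<theta>)))\<^sup>2 / (2 * real N)" for x
  define A where "A = {x \<in> space P.
      norm ((1 / real N) *\<^sub>R (\<Sum>i\<in>{1..N}. g (x i)) - (\<integral>x. g x \<partial>tilted \<mu> H \<theta>)) \<ge> \<epsilon>}"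
  have A: "A \<in> P.events"
    unfolding A_def P_def by measurable
  note moments = tilted_moments_at_minimizer[OF assms(1-5)]
  have inner: "(H x - (y - \<theta>)) \<bullet> b = b \<bullet> H x - b \<bullet> (y - \<theta>)" for x b
    by (metis inner_commute inner_diff_right)
  have sq: "integrable (tilted \<mu> H \<theta>) (\<lambda>x. ((H x - (y - \<theta>)) \<bullet> b)\<^sup>2)" for b
    unfolding inner power2_diff using moments(1,2)[of b] by simp
  \<comment> \<open>Here minimality enters: \<open>y - \<theta>\<close> is the mean of
    \<open>H\<close>, so the summands in \<open>Z\<close> are centred.\<close>
  have mean: "T.expectation (\<lambda>x. (H x - (y - \<theta>)) \<bullet> b) = 0" for b
    unfolding inner using moments(2,3)[of b] by (simp add: T.prob_space)
  note Z = T.expectation_norm_square_sum_PiM[of "{1..N}" "\<lambda>x. H x - (y - \<theta>)", OF _ _ sq mean,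
      folded P_def]
  have intZ: "integrable P Z"
    unfolding Z_def using Z(1) by auto
  \<comment> \<open>The sum has second moment \<open>N * (2 * a)\<close>, and \<open>Z\<close>
    divides by \<open>2 * N\<close>.\<close>
  have expZ: "P.expectation Z \<le> a"
    unfolding Z_def a_def using Z(2) \<open>N \<ge> 1\<close> by simp
  have "emeasure (pi_N \<mu> H y N) A
      = (\<integral>\<^sup>+x. ennreal (exp (- Z x)) * indicator A x \<partial>P) / (\<integral>\<^sup>+x. ennreal (exp (- Z x)) \<partial>P)"
    unfolding Z_def P_def using A sets_P assms by (intro emeasure_pi_N) auto
  also have "\<dots> \<le> ennreal (exp a * P.prob A)"
    by (rule P.exp_weighted_prob_le[OF intZ _ expZ A]) (simp add: Z_def)
  finally have "measure (pi_N \<mu> H y N) A \<le> exp a * P.prob A"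
    by (simp add: measure_def enn2real_leI)
  also have "P.prob A \<le> 2 * DIM('b) * exp (- real N * \<epsilon>\<^sup>2 / (2 * (B * DIM('b))\<^sup>2))"
    using T.Hoeffding_PiM_vector[of "{1..N}" g B \<epsilon>] B \<open>N \<ge> 1\<close> \<open>\<epsilon> \<ge> 0\<close>
    by (simp add: A_def P_def)
  finally show ?thesis
    unfolding space_P A_def by simp
qed

theorem proposition5:
  fixes \<mu> :: "(real^'d) measure"
    and H :: "real^'d \<Rightarrow> real^'n"
    and y \<theta>s :: "real^'n"
    and lam :: "nat \<Rightarrow> real"
    and g :: "real^'d \<Rightarrow> real^'m"
  assumes "prob_space \<mu>" and "sets \<mu> = sets borel"
    and "H \<in> borel_measurable borel"
    and "open (Theta_dom \<mu> H)"
    and "\<And>a b. a \<noteq> 0 \<Longrightarrow> \<not> (AE x in \<mu>. H x \<in> {v. a \<bullet> v = b})"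
    and "\<theta>s \<in> Theta_dom \<mu> H" and "is_arg_min (J_fun \<mu> H y) (\<lambda>_. True) \<theta>s"
    and "\<And>N. N \<ge> 1 \<Longrightarrow> lam N > 0"
    and "filterlim lam at_top sequentially"
    and "(\<lambda>N. (lam N)\<^sup>2 / real N) \<longlonglongrightarrow> 0"
    and "g \<in> borel_measurable borel" and "bounded (range g)"
  shows "\<exists>c>0. \<exists>r. r \<in> o(\<lambda>N. (lam N)\<^sup>2) \<and>
    (\<forall>\<^sub>F N in sequentially.
       measure (pi_N \<mu> H y N)
         {x \<in> space (pi_N \<mu> H y N).
            norm ((1 / real N) *\<^sub>R (\<Sum>i\<in>{1..N}. g (x i)) - (\<integral>x. g x \<partial>tilted \<mu> H \<theta>s))
              \<ge> lam N / sqrt (real N)}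
       \<le> exp (- c * (lam N)\<^sup>2 + r N))"
proof -
  obtain B where B: "B > 0" "\<And>x. norm (g x) \<le> B"
    using \<open>bounded (range g)\<close> by (auto simp: bounded_pos)
  have meas: "H \<in> borel_measurable \<mu>" "g \<in> borel_measurable \<mu>"
    using assms(2,3,11) by (simp_all cong: measurable_cong_sets)
  define a where "a = (\<integral>x. (norm (H x - (y - \<theta>s)))\<^sup>2 \<partial>tilted \<mu> H \<theta>s) / 2"
  define D where "D = DIM(real^'m)"
  \<comment> \<open>The Hoeffding rate at \<open>\<epsilon> = lam N / sqrt (real N)\<close>, where
    \<open>real N * \<epsilon>\<^sup>2 = (lam N)\<^sup>2\<close>.\<close>
  define c where "c = 1 / (2 * (B * D)\<^sup>2)"
  \<comment> \<open>The prefactors \<open>exp a\<close> and \<open>2 * D\<close> moved into the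
    exponent; as a constant, \<open>r\<close> is negligible against \<open>(lam N)\<^sup>2\<close>,
    which tends to infinity.\<close>
  define r where "r = a + ln (2 * D)"
  have D: "D > 0"
    unfolding D_def by (rule DIM_positive)
  have "(\<lambda>_. r) \<in> o(\<lambda>N. (lam N)\<^sup>2)"
  proof (rule smalloI_tendsto)
    have "filterlim (\<lambda>N. (lam N)\<^sup>2) at_top sequentially"
      using assms(9) by (intro filterlim_pow_at_top) auto
    then show "(\<lambda>N. r / (lam N)\<^sup>2) \<longlonglongrightarrow> 0"
      by (intro real_tendsto_divide_at_top[OF tendsto_const])
    show "\<forall>\<^sub>F N in sequentially. (lam N)\<^sup>2 \<noteq> 0"
      using eventually_ge_at_top[of 1] by eventually_elim (use assms(8) in force)
  qed
  moreover have "measure (pi_N \<mu> H y N) {x \<in> space (pi_N \<mu> H y N).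
      norm ((1 / real N) *\<^sub>R (\<Sum>i\<in>{1..N}. g (x i)) - (\<integral>x. g x \<partial>tilted \<mu> H \<theta>s))
        \<ge> lam N / sqrt (real N)} \<le> exp (- c * (lam N)\<^sup>2 + r)" if N: "N \<ge> 1" for N
  proof -
    have "- real N * (lam N / sqrt (real N))\<^sup>2 / (2 * (B * D)\<^sup>2) = - c * (lam N)\<^sup>2"
      using N by (simp add: c_def power_divide)
    moreover have "exp r = exp a * (2 * real D)"
      using D by (simp add: r_def exp_add)
    ultimately have "exp (- c * (lam N)\<^sup>2 + r)
        = exp a * (2 * real D * exp (- real N * (lam N / sqrt (real N))\<^sup>2 / (2 * (B * D)\<^sup>2)))"
      unfolding exp_add by simp
    then show ?thesis
      using pi_N_deviation_le[OF assms(1) meas(1) assms(4,6,7) meas(2) B N, of "lam N / sqrt (real N)"]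
        assms(8)[OF N] N
      by (simp add: a_def D_def)
  qed
  moreover have "c > 0"
    using B D by (simp add: c_def)
  ultimately show ?thesis
    by (intro exI[of _ c] conjI exI[of _ "\<lambda>_. r"] eventually_sequentiallyI[of 1]) auto
qed

end
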